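(* Let $a<b$ be real numbers and let $f:[a,b]\to\mathbb{R}$ be a function of bounded variation on $[a,b]$. Then $$\|f\|_{[a,b],\infty}\le \frac{1}{b-a}\left|\int_a^b f(t)\,dt\right|+\bigvee\nolimits_a^b(f).$$ The multiplicative constant $1$ in front of $\bigvee_a^b(f)$ cannot be replaced by a smaller quantity; that is, if $C>0$ is a constant such that $\|f\|_{[a,b],\infty}\le \frac{1}{b-a}\left|\int_a^b f(t)\,dt\right|+C\bigvee_a^b(f)$ holds for every function $f:[a,b]\to\mathbb{R}$ of bounded variation, then $C\ge 1$.
   Context: $\|f\|_{[a,b],\infty}:=\operatorname{ess\,sup}_{t\in[a,b]}|f(t)|$. $\bigvee_a^b(f)$ denotes the total variation of $f$ on $[a,b]$. *)

theory Defs
  imports "HOL-Analysis.Analysis" "HOL-Probability.Essential_Supremum"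
begin

text \<open>
  A function \<open>[a,b] \<rightarrow> \<real>\<close> is rendered as a total function on the reals; all notions below depend
  only on its values on \<open>{a..b}\<close>.
\<close>

text \<open>
  Partitions \<open>a = x\<^sub>0 < x\<^sub>1 < \<dots> < x\<^sub>n = b\<close>. Only \<open>x 0, \<dots>, x n\<close> matter; \<open>x\<close> is otherwise arbitrary.
\<close>

definition partitions :: "real \<Rightarrow> real \<Rightarrow> (nat \<times> (nat \<Rightarrow> real)) set" where
  "partitions a b = {(n, x). x 0 = a \<and> x n = b \<and> (\<forall>i<n. x i < x (Suc i))}"

definition total_variation :: "real \<Rightarrow> real \<Rightarrow> (real \<Rightarrow> real) \<Rightarrow> ereal" where
  "total_variation a b f =
     (SUP (n, x) \<in> partitions a b. ereal (\<Sum>i<n. \<bar>f (x (Suc i)) - f (x i)\<bar>))"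

definition bounded_variation :: "real \<Rightarrow> real \<Rightarrow> (real \<Rightarrow> real) \<Rightarrow> bool" where
  "bounded_variation a b f \<longleftrightarrow> total_variation a b f < \<infinity>"

definition ess_sup_norm :: "real \<Rightarrow> real \<Rightarrow> (real \<Rightarrow> real) \<Rightarrow> ereal" where
  "ess_sup_norm a b f = esssup (lebesgue_on {a..b}) (\<lambda>t. ereal \<bar>f t\<bar>)"

end

theory Submission
  imports Defs
begin

text \<open>
  A function of bounded variation is a difference of two increasing functions, hence integrable,
  and any two of its values differ by at most its total variation \<open>V\<close>. Averaging
  \<open>f x - V \<le> f t \<le> f x + V\<close> over \<open>t\<close> bounds \<open>\<bar>f x\<bar>\<close>. Sharpness: the indicator of \<open>[a,d]\<close> has
  supremum and variation 1, while its integral tends to 0 as \<open>d\<close> approaches \<open>a\<close>.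
\<close>

lemma partitions_snoc:
  assumes "(n, x) \<in> partitions a s" "s < t"
  shows "(Suc n, x(Suc n := t)) \<in> partitions a t"
  using assms by (auto simp: partitions_def less_Suc_eq)

lemma total_variation_upper:
  assumes "(n, x) \<in> partitions a b"
  shows "ereal (\<Sum>i<n. \<bar>f (x (Suc i)) - f (x i)\<bar>) \<le> total_variation a b f"
  unfolding total_variation_def using assms by (rule SUP_upper2) simp

text \<open>Appending \<open>t\<close> to a partition of \<open>{a..s}\<close> adds exactly the
  summand \<open>\<bar>f t - f s\<bar>\<close>. Monotonicity, the oscillation bound and the Jordan
  decomposition all rest on this inequality. For \<open>s < a\<close> there are no partitions, so
  the left side is \<open>-\<infinity>\<close>.\<close>

lemma total_variation_add_le:
  assumes "s \<le> t"
  shows "total_variation a s f + ereal \<bar>f t - f s\<bar> \<le> total_variation a t f"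
proof (cases "s = t")
  case False
  with assms have st: "s < t" by simp
  \<comment> \<open>With the increment moved to the right, a bare supremum remains on the left and
    can be bounded partition by partition.\<close>
  have "total_variation a s f \<le> total_variation a t f - ereal \<bar>f t - f s\<bar>"
    unfolding total_variation_def[of a s f]
  proof (rule SUP_least, clarify)
    fix n x assume p: "(n, x) \<in> partitions a s"
    then have "x n = s" by (simp add: partitions_def)
    moreover have "(\<Sum>i<n. \<bar>f ((x(Suc n := t)) (Suc i)) - f ((x(Suc n := t)) i)\<bar>)
        = (\<Sum>i<n. \<bar>f (x (Suc i)) - f (x i)\<bar>)"
      by (intro sum.cong) auto
    ultimately have "ereal ((\<Sum>i<n. \<bar>f (x (Suc i)) - f (x i)\<bar>) + \<bar>f t - f s\<bar>) \<le> total_variation a t f"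
      using total_variation_upper[OF partitions_snoc[OF p st], of f] by simp
    then show "ereal (\<Sum>i<n. \<bar>f (x (Suc i)) - f (x i)\<bar>) \<le> total_variation a t f - ereal \<bar>f t - f s\<bar>"
      by (simp add: ereal_le_minus)
  qed
  then show ?thesis by (simp add: ereal_le_minus)
qed simp

lemma total_variation_refl_nonneg: "0 \<le> total_variation a a f"
  \<comment> \<open>The one-point partition \<open>n = 0\<close> contributes the empty sum
    0.\<close>
  using total_variation_upper[of 0 "\<lambda>_. a" a a f] by (simp add: partitions_def zero_ereal_def)

lemma total_variation_mono:
  assumes "s \<le> t"
  shows "total_variation a s f \<le> total_variation a t f"
proof -
  have "total_variation a s f + 0 \<le> total_variation a s f + ereal \<bar>f t - f s\<bar>"
    by (intro add_left_mono) simp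
  with total_variation_add_le[OF assms, of a f] show ?thesis by simp
qed

lemma total_variation_nonneg: "a \<le> b \<Longrightarrow> 0 \<le> total_variation a b f"
  using total_variation_refl_nonneg total_variation_mono order_trans by blast

lemma abs_diff_le_total_variation:
  assumes "s \<in> {a..b}" "t \<in> {a..b}"
  shows "ereal \<bar>f t - f s\<bar> \<le> total_variation a b f"
  using assms
\<comment> \<open>By symmetry \<open>s \<le> t\<close>; then discard the variation before
  \<open>s\<close> and after \<open>t\<close>.\<close>
proof (induction s t rule: linorder_wlog)
  case (le s t)
  have "0 + ereal \<bar>f t - f s\<bar> \<le> total_variation a s f + ereal \<bar>f t - f s\<bar>"
    using le by (intro add_right_mono total_variation_nonneg) auto
  also have "\<dots> \<le> total_variation a t f"
    using le by (intro total_variation_add_le)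
  also have "\<dots> \<le> total_variation a b f"
    using le by (intro total_variation_mono) auto
  finally show ?case by simp
qed (simp add: abs_minus_commute)

lemma bounded_variation_jordan:
  assumes "bounded_variation a b f"
  obtains g h where "mono_on {a..b} g" "mono_on {a..b} h" "f = (\<lambda>t. g t - h t)"
proof
  \<comment> \<open>The variation function of \<open>f\<close>; the second increasing function is
    \<open>g - f\<close>. Values of \<open>g\<close> outside \<open>{a..b}\<close> do not
    matter.\<close>
  define g where "g = (\<lambda>t. real_of_ereal (total_variation a t f))"
  have g: "ereal (g t) = total_variation a t f" if "t \<in> {a..b}" for t
  proof -
    have "total_variation a t f < \<infinity>"
      using total_variation_mono[of t b a f] that assms
      by (auto simp: bounded_variation_def)
    with total_variation_nonneg[of a t f] that show ?thesis
      by (cases "total_variation a t f") (auto simp: g_def)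
  qed
  \<comment> \<open>Bounding the absolute value below by 0 makes \<open>g\<close> increasing, and by
    \<open>f t - f s\<close> makes \<open>g - f\<close> increasing.\<close>
  have *: "g s + \<bar>f t - f s\<bar> \<le> g t" if "s \<in> {a..b}" "t \<in> {a..b}" "s \<le> t" for s t
    using total_variation_add_le[of s t a f] that by (simp flip: g)
  show "mono_on {a..b} g"
    by (rule mono_onI) (use * in force)
  show "mono_on {a..b} (\<lambda>t. g t - f t)"
    by (rule mono_onI) (use * in force)
qed auto

lemma bounded_variation_integrable:
  assumes "bounded_variation a b f"
  shows "integrable (lebesgue_on {a..b}) f"
proof -
  obtain g h where "mono_on {a..b} g" "mono_on {a..b} h" "f = (\<lambda>t. g t - h t)"
    using bounded_variation_jordan[OF assms] .
  then show ?thesis by (simp add: integrable_mono_on)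
qed

lemma bounded_variation_abs_le:
  assumes "a < b" "bounded_variation a b f" "x \<in> {a..b}"
  shows "ereal \<bar>f x\<bar> \<le> ereal (1 / (b - a) * \<bar>integral {a..b} f\<bar>) + total_variation a b f"
proof -
  obtain V where V: "total_variation a b f = ereal V"
    using assms total_variation_nonneg[of a b f]
    by (cases "total_variation a b f") (auto simp: bounded_variation_def)
  have osc: "\<bar>f x - f t\<bar> \<le> V" if "t \<in> {a..b}" for t
    using abs_diff_le_total_variation[of t a b x f] that assms(3) V by simp
  have int: "f integrable_on {a..b}"
    using bounded_variation_integrable[OF assms(2)] by (simp add: integrable_on_lebesgue_on)
  have "integral {a..b} (\<lambda>_. f x - V) \<le> integral {a..b} f"
    using osc by (intro integral_le int) (auto simp: abs_le_iff algebra_simps)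
  moreover have "integral {a..b} f \<le> integral {a..b} (\<lambda>_. f x + V)"
    using osc by (intro integral_le int) (auto simp: abs_le_iff algebra_simps)
  \<comment> \<open>The constants \<open>f x - V\<close> and \<open>f x + V\<close> integrate to
    \<open>b - a\<close> times themselves; the sign of \<open>f x\<close> decides which of the two
    bounds applies.\<close>
  ultimately have "(b - a) * \<bar>f x\<bar> \<le> \<bar>integral {a..b} f\<bar> + (b - a) * V"
    using assms(1) by (auto simp: abs_if algebra_simps)
  then have "\<bar>f x\<bar> \<le> 1 / (b - a) * \<bar>integral {a..b} f\<bar> + V"
    using assms(1) by (simp add: field_simps)
  then show ?thesis by (simp add: V)
qed

lemma ess_sup_norm_le:
  assumes "f \<in> borel_measurable (lebesgue_on {a..b})" "\<And>x. x \<in> {a..b} \<Longrightarrow> ereal \<bar>f x\<bar> \<le> c"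
  shows "ess_sup_norm a b f \<le> c"
  unfolding ess_sup_norm_def
proof (rule esssup_I)
  show "(\<lambda>t. ereal \<bar>f t\<bar>) \<in> borel_measurable (lebesgue_on {a..b})"
    using assms(1) by measurable
qed (use assms(2) in \<open>auto intro!: AE_I2 simp: space_restrict_space\<close>)

text \<open>If the essential supremum were below \<open>K\<close>, the whole interval
  \<open>{c..d}\<close> would lie in the exceptional null set, although its measure
  \<open>d - c\<close> is positive.\<close>

lemma le_ess_sup_norm:
  assumes "a \<le> c" "c < d" "d \<le> b" "\<And>x. x \<in> {c..d} \<Longrightarrow> K \<le> \<bar>f x\<bar>"
  shows "ereal K \<le> ess_sup_norm a b f"
proof (rule ccontr)
  assume "\<not> ?thesis"
  then have lt: "ess_sup_norm a b f < ereal K" by simp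
  have "AE x in lebesgue_on {a..b}. ereal \<bar>f x\<bar> \<le> ess_sup_norm a b f"
    unfolding ess_sup_norm_def by (rule esssup_AE)
  then have "AE x in lebesgue. x \<in> {a..b} \<longrightarrow> ereal \<bar>f x\<bar> \<le> ess_sup_norm a b f"
    by (simp add: AE_restrict_space_iff)
  then have "AE x in lebesgue. x \<notin> {c..d}"
  proof eventually_elim
    case (elim x)
    show ?case
    proof
      assume x: "x \<in> {c..d}"
      then have "ereal K \<le> ereal \<bar>f x\<bar>" using assms(4) by simp
      also have "\<dots> \<le> ess_sup_norm a b f" using elim x assms(1,3) by simp
      finally show False using lt by simp
    qed
  qed
  then have "{c..d} \<in> null_sets lebesgue"
    by (subst AE_iff_null_sets) auto
  then show False
    using \<open>c < d\<close> by (auto simp: null_sets_def)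
qed

text \<open>No increment is positive, so every partition sum telescopes to the same value
  \<open>f a - f b\<close>.\<close>

lemma total_variation_antimono_le:
  assumes "antimono f"
  shows "total_variation a b f \<le> ereal (f a - f b)"
  unfolding total_variation_def
proof (rule SUP_least, clarify)
  fix n x assume p: "(n, x) \<in> partitions a b"
  have "(\<Sum>i<n. \<bar>f (x (Suc i)) - f (x i)\<bar>) = (\<Sum>i<n. f (x i) - f (x (Suc i)))"
    using p assms by (intro sum.cong) (auto simp: partitions_def antimono_def less_imp_le)
  also have "\<dots> = f (x 0) - f (x n)" by (rule sum_lessThan_telescope')
  finally show "ereal (\<Sum>i<n. \<bar>f (x (Suc i)) - f (x i)\<bar>) \<le> ereal (f a - f b)"
    using p by (simp add: partitions_def)
qed

theorem theorem1:
  fixes a b :: real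
  assumes "a < b"
  shows "(\<forall>f :: real \<Rightarrow> real. bounded_variation a b f \<longrightarrow>
            ess_sup_norm a b f
              \<le> ereal (1 / (b - a) * \<bar>integral {a..b} f\<bar>) + total_variation a b f)
       \<and> (\<forall>C :: real. C > 0 \<longrightarrow>
            (\<forall>f :: real \<Rightarrow> real. bounded_variation a b f \<longrightarrow>
               ess_sup_norm a b f
                 \<le> ereal (1 / (b - a) * \<bar>integral {a..b} f\<bar>) + ereal C * total_variation a b f)
            \<longrightarrow> C \<ge> 1)"
proof (intro conjI allI impI)
  fix f :: "real \<Rightarrow> real" assume "bounded_variation a b f"
  then show "ess_sup_norm a b f
      \<le> ereal (1 / (b - a) * \<bar>integral {a..b} f\<bar>) + total_variation a b f"
    using assms bounded_variation_integrable
    by (intro ess_sup_norm_le bounded_variation_abs_le) auto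
next
  fix C :: real
  assume C: "C > 0" and bound: "\<forall>f :: real \<Rightarrow> real. bounded_variation a b f \<longrightarrow>
     ess_sup_norm a b f
       \<le> ereal (1 / (b - a) * \<bar>integral {a..b} f\<bar>) + ereal C * total_variation a b f"
  show "C \<ge> 1"
  proof (rule ccontr)
    assume "\<not> C \<ge> 1"
    then have C1: "C < 1" by simp
    \<comment> \<open>The mean of the indicator of \<open>{a..d}\<close> is then
      \<open>(1 - C) / 2\<close>, half of the gap between \<open>C\<close> and 1. Here
      \<open>C < 1\<close> gives \<open>a < d\<close>, and \<open>C > 0\<close> gives
      \<open>d < b\<close>.\<close>
    define d where "d = a + (1 - C) / 2 * (b - a)"
    have ad: "a < d" using assms C1 by (simp add: d_def)
    have "(1 - C) / 2 * (b - a) < 1 * (b - a)"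
      using assms C by (intro mult_strict_right_mono) auto
    then have db: "d < b" by (simp add: d_def)
    define f where "f = (\<lambda>t. if t \<le> d then 1 else 0 :: real)"
    have tv: "total_variation a b f \<le> 1"
      using total_variation_antimono_le[of f a b] ad db by (simp add: f_def antimono_def one_ereal_def)
    then have bv: "bounded_variation a b f"
      by (auto simp: bounded_variation_def)
    have "((\<lambda>_. 1 :: real) has_integral (d - a)) {a..d}"
      using has_integral_const_real[of "1::real" a d] ad by simp
    then have "(f has_integral (d - a)) {a..d}"
      by (rule has_integral_eq[rotated]) (simp add: f_def)
    moreover have "(f has_integral 0) {d..b}"
      \<comment> \<open>On \<open>{d..b}\<close> the function differs from 0 only at
        \<open>d\<close>, where it is 1.\<close>
      by (rule has_integral_spike_finite[where S = "{d}" and f = "\<lambda>_. 0"]) (auto simp: f_def)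
    ultimately have "(f has_integral (d - a + 0)) {a..b}"
      using ad db by (intro has_integral_combine[where c = d]) auto
    then have int: "integral {a..b} f = d - a" by (simp add: integral_unique)
    have "1 \<le> ess_sup_norm a b f"
      using le_ess_sup_norm[of a a d b 1 f] ad db by (simp add: f_def one_ereal_def)
    also have "\<dots> \<le> ereal (1 / (b - a) * (d - a)) + ereal C * total_variation a b f"
      using bound bv int ad by fastforce
    also have "\<dots> \<le> ereal (1 / (b - a) * (d - a)) + ereal C * 1"
      using tv C by (intro add_left_mono ereal_mult_left_mono) auto
    also have "1 / (b - a) * (d - a) = (1 - C) / 2"
      using assms by (simp add: d_def)
    \<comment> \<open>The chain reads \<open>1 \<le> (1 - C) / 2 + C\<close>, that is
      \<open>1 \<le> (1 + C) / 2\<close>, contradicting \<open>C < 1\<close>.\<close>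
    finally show False
      using C1 by (simp add: one_ereal_def field_simps)
  qed
qed

end
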